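(* Let $Z_*$ be the limit in distribution of $\hat Z_N$ as $N\to\infty$. The sequence of moments $m_{2n}={\bf E}Z_*^{2n}$ (with $m_0=1$) satisfies, for every $n=1,2,\ldots$, the recurrences \[ m_{2n}=\frac{1}{(2n+1)(2^{2n}-1)}\sum_{j=1}^{n}\binom{2n+1}{2j+1}3^{2j}m_{2n-2j}; \] \[ m_{2n}=\sum_{j=1}^{n}\binom{2n-1}{2j-1}\frac{B_{2j}}{2j}\,\frac{6^{2j}}{2^{2j}-1}\,m_{2n-2j}; \] \[ m_{2n}=\frac{2^{2n}}{1-2^{2n}}\sum_{j=1}^{n}\binom{2n}{2j}3^{2j}B_{2j}\!\left(\tfrac12\right)m_{2n-2j}, \] where $B_{2j}\left(\tfrac12\right)$ is the value of the Bernoulli polynomial of degree $2j$ at $x=\tfrac12$.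
   Context: For each integer $N\ge 1$, let $\Omega_N$ be the set of all $\omega=(k_1,\ldots,k_N)$ of integers with $0\le k_j\le 2^j-1$, $j=1,\ldots,N$, equipped with the uniform probability ${\bf P}(\omega)=2^{-N(N+1)/2}$, and let $Z_N(\omega)=k_1+\cdots+k_N$. Let $\mu_N={\bf E}Z_N$, $\sigma_N^2={\bf Var}\,Z_N$ (with $\sigma_N>0$), and $\hat Z_N=(Z_N-\mu_N)/\sigma_N$. The sequence $\hat Z_N$ converges in distribution as $N\to\infty$ to a random variable denoted $Z_*$, which satisfies $Z_*\overset{d}{=}\sum_{i=1}^\infty U_i/2^i$ with $U_1,U_2,\ldots$ independent and uniformly distributed on $[-3,3]$. The Bernoulli numbers $B_n$ are defined by $\sum_{n=0}^\infty B_n t^n/n!=t/(e^t-1)$ and the Bernoulli polynomials $B_n(x)$ by $\sum_{n=0}^\infty B_n(x) t^n/n!=te^{xt}/(e^t-1)$. *)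

theory Defs
  imports
    "HOL-Probability.Probability"
    "HOL-Computational_Algebra.Formal_Power_Series"
begin

text \<open>Elements of \<open>\<Omega>\<^sub>N\<close> are functions with domain \<open>{1..N}\<close> (extensional, i.e. \<open>undefined\<close> elsewhere).\<close>

definition Omega :: "nat \<Rightarrow> (nat \<Rightarrow> int) set" where
  "Omega N = (\<Pi>\<^sub>E j\<in>{1..N}. {0..2 ^ j - 1})"

definition P :: "nat \<Rightarrow> (nat \<Rightarrow> int) pmf" where
  "P N = pmf_of_set (Omega N)"

definition ZN :: "nat \<Rightarrow> (nat \<Rightarrow> int) \<Rightarrow> real" where
  "ZN N \<omega> = (\<Sum>j=1..N. real_of_int (\<omega> j))"

definition muN :: "nat \<Rightarrow> real" where
  "muN N = measure_pmf.expectation (P N) (ZN N)"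

definition sigmaN :: "nat \<Rightarrow> real" where
  "sigmaN N = sqrt (measure_pmf.variance (P N) (ZN N))"

text \<open>For \<open>N = 0\<close> this is the constant \<open>0\<close> (division by zero), which is
  irrelevant for limits as \<open>N \<rightarrow> \<infinity>\<close>.\<close>

definition ZN_hat :: "nat \<Rightarrow> (nat \<Rightarrow> int) \<Rightarrow> real" where
  "ZN_hat N \<omega> = (ZN N \<omega> - muN N) / sigmaN N"

text \<open>Here \<open>/\<close> is division of formal power series; it is exact because numerator and
  denominator both have subdegree at least 1, see \<open>bernoulli_poly_gf\<close>.\<close>

definition bernoulli_num :: "nat \<Rightarrow> real" where
  "bernoulli_num n = fact n * fps_nth (fps_X / (fps_exp 1 - 1)) n"

definition bernoulli_poly :: "nat \<Rightarrow> real \<Rightarrow> real" where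
  "bernoulli_poly n x = fact n * fps_nth (fps_X * fps_exp x / (fps_exp 1 - 1)) n"

lemma finite_Omega: "finite (Omega N)"
  unfolding Omega_def by (intro finite_PiE) auto

lemma Omega_nonempty: "Omega N \<noteq> {}"
  unfolding Omega_def by (subst PiE_eq_empty_iff) auto

lemma card_Omega: "card (Omega N) = 2 ^ (N * (N + 1) div 2)"
proof -
  have "card (Omega N) = (\<Prod>j=1..N. 2 ^ j)"
    unfolding Omega_def by (subst card_PiE) (auto intro!: prod.cong simp: nat_power_eq)
  also have "\<dots> = 2 ^ (\<Sum>j=1..N. j)"
    by (simp add: power_sum)
  also have "(\<Sum>j=1..N. j) = N * (N + 1) div 2"
    using gauss_sum_from_Suc_0[of N, where ?'a = nat] by simp
  finally show ?thesis .
qed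

lemma pmf_P: "\<omega> \<in> Omega N \<Longrightarrow> pmf (P N) \<omega> = 1 / 2 ^ (N * (N + 1) div 2)"
  by (simp add: P_def finite_Omega Omega_nonempty card_Omega)

lemma bernoulli_poly_gf:
  "Abs_fps (\<lambda>n. bernoulli_poly n x / fact n) * (fps_exp 1 - 1) = fps_X * fps_exp x"
proof -
  have "fps_exp 1 - 1 \<noteq> (0 :: real fps)"
  proof
    assume "fps_exp 1 - 1 = (0 :: real fps)"
    hence "fps_nth (fps_exp 1 - 1 :: real fps) 1 = 0" by (simp only: fps_zero_nth)
    thus False by simp
  qed
  moreover from this have "subdegree (fps_exp 1 - 1 :: real fps) = 1"
    by (intro subdegreeI) auto
  moreover have "1 \<le> subdegree (fps_X * fps_exp x :: real fps)"
    by (intro subdegree_geI) auto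
  ultimately have "(fps_exp 1 - 1 :: real fps) dvd fps_X * fps_exp x"
    by (auto simp: fps_dvd_iff)
  moreover have "Abs_fps (\<lambda>n. bernoulli_poly n x / fact n) = fps_X * fps_exp x / (fps_exp 1 - 1)"
    by (simp add: bernoulli_poly_def fps_eq_iff)
  ultimately show ?thesis by simp
qed

lemma bernoulli_num_gf:
  "Abs_fps (\<lambda>n. bernoulli_num n / fact n) * (fps_exp 1 - 1) = fps_X"
  using bernoulli_poly_gf[of 0] by (simp add: bernoulli_poly_def bernoulli_num_def)

end

theory Submission
  imports Defs
begin

text \<open>
  Since \<open>Z\<^sub>N\<^sub>+\<^sub>1 = Z\<^sub>N + k\<^sub>N\<^sub>+\<^sub>1\<close> with independent summands, the limit law is
  self-similar: \<open>2 Z\<close> has the law of \<open>U + Z\<close>, where \<open>U\<close> is uniform on \<open>[-3, 3]\<close> and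
  independent of \<open>Z\<close>. Only the moments of this identity are needed,
  \<open>2 ^ k \<mu>\<^sub>k = (\<Sum>i\<le>k. (k choose i) E(U ^ i) \<mu>\<^sub>k\<^sub>-\<^sub>i)\<close>,
  and they can be obtained without characteristic functions or a limiting random series.
  Expanding the powers of \<open>Z\<^sub>N\<^sub>+\<^sub>1\<close> binomially gives an exact recurrence for its
  central moments (\<open>centred_moment_Suc\<close>). Divide it by \<open>2 ^ (N k)\<close>: the moments of the
  uniform grid become Riemann sums of \<open>x ^ i\<close> (\<open>grid_moment_LIMSEQ\<close>), the standard deviation
  is asymptotic to \<open>2 ^ N / 3\<close> (\<open>sigmaN_LIMSEQ\<close>), and the moments of the normalised variables
  converge to those of \<open>Z\<close> because all of these variables take values in \<open>[-4, 4]\<close>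
  (\<open>ZN_hat_moments_converge\<close>).

  The rest is algebra of exponential generating functions. Let \<open>F\<close> be that of the moments of
  \<open>Z\<close> and \<open>S = sinh (3t) / (3t)\<close> that of the moments of \<open>U\<close>. The identity above says
  \<open>F(2t) = S(t) F(t)\<close> (\<open>egf_functional_equation\<close>), and each claimed recurrence is one way of
  comparing coefficients in it. Comparing them directly gives the first one. The inverse of \<open>S\<close>
  is \<open>3t / sinh (3t)\<close>, the generating function of \<open>6 ^ k B\<^sub>k(1/2)\<close>, so that
  \<open>F(t) = S(t)\<inverse> F(2t)\<close> gives the third one. With \<open>G = t F'/F\<close>, logarithmic
  differentiation gives \<open>G(2t) - G(t) = t S'/S = 3t coth (3t) - 1\<close>, whose coefficients are
  Bernoulli numbers; this determines \<open>G\<close>, and \<open>t F' = G F\<close> is the second recurrence.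
  The law is symmetric, so the terms of odd index drop out of all three sums.
\<close>

section \<open>Integration over one more digit\<close>

lemma expectation_P: "measure_pmf.expectation (P N) f = (\<Sum>\<omega>\<in>Omega N. f \<omega>) / real (card (Omega N))"
  for f :: "_ \<Rightarrow> real"
  by (simp add: P_def integral_pmf_of_set finite_Omega Omega_nonempty)

lemma integrable_P [simp]: "integrable (measure_pmf (P N)) f"
  for f :: "_ \<Rightarrow> real"
  by (rule integrable_measure_pmf_finite) (simp add: P_def finite_Omega Omega_nonempty)

text \<open>
  This is the independence of \<open>k\<^sub>N\<^sub>+\<^sub>1\<close> from \<open>k\<^sub>1, \<dots>, k\<^sub>N\<close>: the uniform measure on the
  product set \<open>\<Omega>\<^sub>N\<^sub>+\<^sub>1\<close> is integrated one coordinate at a time.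
\<close>

lemma expectation_P_Suc:
  fixes f :: "(nat \<Rightarrow> int) \<Rightarrow> real"
  shows "measure_pmf.expectation (P (Suc N)) f =
    measure_pmf.expectation (P N) (\<lambda>w. (\<Sum>x<2 ^ Suc N. f (w(Suc N := int x))) / 2 ^ Suc N)"
proof -
  let ?D = "{0..2 ^ Suc N - 1 :: int}"
  have split: "Omega (Suc N) = (\<lambda>(y, g). g(Suc N := y)) ` (?D \<times> Omega N)"
  proof -
    have "{1..Suc N} = insert (Suc N) {1..N}" by auto
    then show ?thesis unfolding Omega_def by (simp only: PiE_insert_eq)
  qed
  have inj: "inj_on (\<lambda>(y, g). g(Suc N := y)) (?D \<times> Omega N)"
    unfolding Omega_def by (rule inj_combinator) auto
  have card: "real (card (Omega (Suc N))) = 2 ^ Suc N * real (card (Omega N))"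
    by (simp add: split card_image[OF inj] card_cartesian_product nat_power_eq del: power_Suc)
  have D: "(\<Sum>y\<in>?D. h y) = (\<Sum>x<2 ^ Suc N. h (int x))" for h :: "int \<Rightarrow> real"
    by (rule sum.reindex_bij_witness[of _ int nat])
       (auto simp: nat_less_iff zless_nat_eq_int_zless simp del: power_Suc)
  have "(\<Sum>\<omega>\<in>Omega (Suc N). f \<omega>) = (\<Sum>(y, g)\<in>?D \<times> Omega N. f (g(Suc N := y)))"
    unfolding split sum.reindex[OF inj] by (simp add: case_prod_unfold o_def)
  also have "\<dots> = (\<Sum>g\<in>Omega N. \<Sum>y\<in>?D. f (g(Suc N := y)))"
    unfolding sum.cartesian_product[symmetric] by (rule sum.swap)
  finally have "(\<Sum>\<omega>\<in>Omega (Suc N). f \<omega>)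
      = (\<Sum>w\<in>Omega N. \<Sum>x<2 ^ Suc N. f (w(Suc N := int x)))"
    by (simp only: D)
  then show ?thesis
    by (simp add: expectation_P card sum_divide_distrib[symmetric] del: power_Suc)
qed

section \<open>Moments of the uniform grid\<close>

text \<open>The central moments of the uniform distribution on \<open>{0, \<dots>, n - 1}\<close>.\<close>

definition grid_moment :: "nat \<Rightarrow> nat \<Rightarrow> real" where
  "grid_moment n i = (\<Sum>s<n. (real s - (real n - 1) / 2) ^ i) / real n"

text \<open>The moments of the uniform distribution on the interval \<open>[-3, 3]\<close>.\<close>

definition unif_moment :: "nat \<Rightarrow> real" where
  "unif_moment i = (if even i then 3 ^ i / real (Suc i) else 0)"

lemma grid_moment_0 [simp]: "n \<noteq> 0 \<Longrightarrow> grid_moment n 0 = 1"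
  by (simp add: grid_moment_def)

lemma grid_moment_1 [simp]: "grid_moment n (Suc 0) = 0"
proof -
  have sum: "(\<Sum>s<n. real s - c) = real n * (real n - 1) / 2 - n * c" for c :: real
    by (induction n) (auto simp: field_simps)
  have "(\<Sum>s<n. real s - (real n - 1) / 2) = 0" unfolding sum by (simp add: field_simps)
  then show ?thesis by (simp add: grid_moment_def)
qed

lemma grid_moment_2:
  assumes "n \<noteq> 0"
  shows "grid_moment n 2 = (real n ^ 2 - 1) / 12"
proof -
  have "(\<Sum>s<n. (real s - c) ^ 2) =
      real n * (real n - 1) * (2 * real n - 1) / 6 - c * real n * (real n - 1) + n * c ^ 2" for c :: real
    by (induction n) (auto simp: field_simps power2_eq_square)
  then show ?thesis unfolding grid_moment_def
    using assms by (simp only:) (simp add: field_simps power2_eq_square)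
qed

text \<open>
  After division by \<open>n\<close>, the centred grid consists of the midpoints of the \<open>n\<close> equal pieces of
  \<open>[-1/2, 1/2]\<close>, so the scaled moment is a midpoint sum for the integral of \<open>x ^ i\<close> over this
  interval. Since \<open>x ^ i\<close> has Lipschitz constant at most \<open>i\<close> there, the error is at most \<open>i / n\<close>.
\<close>

lemma grid_moment_LIMSEQ: "(\<lambda>n. grid_moment n i / real n ^ i) \<longlonglongrightarrow> unif_moment i / 6 ^ i"
proof -
  define J :: real where "J = ((1/2) ^ (i + 1) - (- 1/2) ^ (i + 1)) / real (i + 1)"
  have J: "unif_moment i / 6 ^ i = J"
  proof -
    have "(3::real) ^ i / 6 ^ i = (1/2) ^ i" by (simp flip: power_divide)
    moreover have "unif_moment i / 6 ^ i = (if even i then 3 ^ i / 6 ^ i / real (Suc i) else 0)"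
      by (simp add: unif_moment_def mult.commute)
    ultimately show ?thesis by (simp add: J_def)
  qed
  have bound: "\<bar>grid_moment n i / real n ^ i - J\<bar> \<le> real i * (1 / real n)" if n: "n > 0" for n
  proof -
    (* F is an antiderivative of x ^ i; y s is the left end of piece number s, x s its midpoint. *)
    define F :: "real \<Rightarrow> real" where "F y = y ^ (i + 1) / real (i + 1)" for y
    define y where "y s = real s / real n - 1/2" for s :: nat
    define x where "x s = (real s - (real n - 1) / 2) / real n" for s :: nat
    have tel: "(\<Sum>s<n. F (y (Suc s)) - F (y s)) = J"
    proof -
      have "y n = 1/2" "y 0 = - 1/2" using n by (simp_all add: y_def)
      then show ?thesis
        unfolding sum_lessThan_telescope[of "\<lambda>s. F (y s)"]
        by (simp only: F_def J_def diff_divide_distrib)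
    qed
    have grid: "grid_moment n i / real n ^ i = (\<Sum>s<n. x s ^ i / real n)"
      unfolding grid_moment_def x_def
      by (simp add: power_divide sum_divide_distrib[symmetric] mult.commute)
    have step: "\<bar>x s ^ i / real n - (F (y (Suc s)) - F (y s))\<bar> \<le> real i / real n ^ 2"
      if s: "s < n" for s
    proof -
      have ys: "y (Suc s) - y s = 1 / real n" using n by (simp add: y_def field_simps)
      have lt: "y s < y (Suc s)" using ys n by (smt (verit) of_nat_0_less_iff divide_pos_pos)
      have F: "DERIV F z :> z ^ i" for z
        unfolding F_def using DERIV_cdivide[OF DERIV_pow[of "i + 1" z], of "real (i + 1)"]
        by (simp del: of_nat_Suc)
      (* The exact integral over the piece is its length times the value at some point of it. *)
      obtain \<xi> where \<xi>: "y s < \<xi>" "\<xi> < y (Suc s)"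
          "F (y (Suc s)) - F (y s) = (y (Suc s) - y s) * \<xi> ^ i"
        using MVT2[OF lt, of F "\<lambda>z. z ^ i"] F by blast
      have low: "y s \<ge> -1/2" by (simp add: y_def)
      have high: "y (Suc s) \<le> 1/2" using s n by (simp add: y_def field_simps)
      have x: "y s < x s" "x s < y (Suc s)"
      proof -
        define h where "h = 1 / real n"
        have "x s = y s + h / 2" using n by (simp add: x_def y_def h_def field_simps)
        moreover have "h > 0" using n by (simp add: h_def)
        ultimately show "y s < x s" "x s < y (Suc s)" using ys unfolding h_def[symmetric] by linarith+
      qed
      have "\<bar>x s ^ i - \<xi> ^ i\<bar> \<le> real i * \<bar>x s - \<xi>\<bar>"
        using norm_power_diff[of "x s" \<xi> i] x \<xi>(1,2) low high by (simp add: abs_le_iff)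
      also have "\<dots> \<le> real i * (1 / real n)"
        using x \<xi> ys by (intro mult_left_mono) auto
      finally have "\<bar>x s ^ i - \<xi> ^ i\<bar> / real n \<le> real i * (1 / real n) / real n"
        by (intro divide_right_mono) auto
      moreover have "x s ^ i / real n - (F (y (Suc s)) - F (y s)) = (x s ^ i - \<xi> ^ i) / real n"
        unfolding \<xi>(3) ys by (simp add: diff_divide_distrib)
      ultimately show ?thesis
        by (simp add: abs_divide power2_eq_square)
    qed
    have "grid_moment n i / real n ^ i - J
        = (\<Sum>s<n. x s ^ i / real n - (F (y (Suc s)) - F (y s)))"
      unfolding grid tel[symmetric] by (simp add: sum_subtractf)
    also have "\<bar>\<dots>\<bar> \<le> (\<Sum>s<n. real i / real n ^ 2)"
      by (rule order_trans[OF sum_abs]) (intro sum_mono step, simp)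
    also have "\<dots> = real i * (1 / real n)"
      using n by (simp add: power2_eq_square)
    finally show ?thesis .
  qed
  have "(\<lambda>n. grid_moment n i / real n ^ i - J) \<longlonglongrightarrow> 0"
  proof (rule Lim_null_comparison)
    show "\<forall>\<^sub>F n in sequentially. norm (grid_moment n i / real n ^ i - J) \<le> real i * (1 / real n)"
      by (rule eventually_mono[OF eventually_gt_at_top[of 0]]) (use bound in simp)
    show "(\<lambda>n. real i * (1 / real n)) \<longlonglongrightarrow> 0"
      using tendsto_mult[OF tendsto_const lim_1_over_n[where 'a=real], of "real i"] by simp
  qed
  then show ?thesis unfolding J by (simp add: LIM_zero_iff)
qed

section \<open>Central moments of the sum\<close>

text \<open>
  This is the mean of \<open>Z\<^sub>N\<close>, but in the explicit form that makes the step from \<open>N\<close> to \<open>N + 1\<close>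
  a plain addition; that it equals the mean comes out of the recurrence below (\<open>muN_eq\<close>).
\<close>

definition centre :: "nat \<Rightarrow> real" where
  "centre N = (\<Sum>j=1..N. (2 ^ j - 1) / 2)"

definition centred_moment :: "nat \<Rightarrow> nat \<Rightarrow> real" where
  "centred_moment N k = measure_pmf.expectation (P N) (\<lambda>\<omega>. (ZN N \<omega> - centre N) ^ k)"

text \<open>
  The centred variable for \<open>N + 1\<close> is the one for \<open>N\<close> plus an independent point of the centred
  grid of \<open>2 ^ (N + 1)\<close> points, so the binomial theorem gives its moments.
\<close>

lemma centred_moment_Suc:
  "centred_moment (Suc N) k =
    (\<Sum>i\<le>k. real (k choose i) * grid_moment (2 ^ Suc N) i * centred_moment N (k - i))"
proof -
  have Z: "ZN (Suc N) (w(Suc N := int x)) - centre (Suc N)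
      = (real x - (real (2 ^ Suc N) - 1) / 2) + (ZN N w - centre N)" for w x
  proof -
    have "ZN N (w(Suc N := int x)) = ZN N w"
      unfolding ZN_def by (intro sum.cong) auto
    then show ?thesis by (simp add: ZN_def centre_def)
  qed
  have "(\<Sum>x<2 ^ Suc N. (ZN (Suc N) (w(Suc N := int x)) - centre (Suc N)) ^ k) / 2 ^ Suc N
      = (\<Sum>i\<le>k. real (k choose i) * grid_moment (2 ^ Suc N) i * (ZN N w - centre N) ^ (k - i))" for w
    unfolding Z binomial_ring grid_moment_def
    by (subst sum.swap) (simp add: sum_divide_distrib sum_distrib_left sum_distrib_right field_simps del: power_Suc)
  then show ?thesis
    unfolding centred_moment_def expectation_P_Suc by simp
qed

lemma centred_moment_0 [simp]: "centred_moment N 0 = 1"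
  by (simp add: centred_moment_def)

lemma centred_moment_1 [simp]: "centred_moment N (Suc 0) = 0"
  by (induction N) (simp add: centred_moment_def expectation_P ZN_def centre_def Omega_def,
     simp add: centred_moment_Suc)

lemma centred_moment_2: "centred_moment N 2 = (4 * (4 ^ N - 1) / 3 - real N) / 12"
proof (induction N)
  case 0
  show ?case by (simp add: centred_moment_def expectation_P ZN_def centre_def)
next
  case (Suc N)
  have "centred_moment (Suc N) 2 = centred_moment N 2 + grid_moment (2 ^ Suc N) 2"
    unfolding centred_moment_Suc by (simp add: numeral_2_eq_2)
  also have "grid_moment (2 ^ Suc N) 2 = (4 ^ Suc N - 1) / 12"
    by (subst grid_moment_2) (simp_all add: power2_eq_square flip: power_mult_distrib)
  finally show ?case using Suc by (simp add: field_simps)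
qed

lemma muN_eq: "muN N = centre N"
proof -
  have "muN N - centre N = centred_moment N 1"
    unfolding centred_moment_def muN_def by simp
  then show ?thesis by simp
qed

lemma sigmaN_eq: "sigmaN N = sqrt (centred_moment N 2)"
  unfolding sigmaN_def centred_moment_def muN_def[symmetric] muN_eq ..

lemma expectation_ZN_hat_power:
  "measure_pmf.expectation (P N) (\<lambda>\<omega>. ZN_hat N \<omega> ^ k) = centred_moment N k / sigmaN N ^ k"
  unfolding centred_moment_def ZN_hat_def muN_eq by (simp add: power_divide)

text \<open>
  The variance \<open>(4 (4 ^ N - 1) / 3 - N) / 12\<close> is asymptotic to \<open>4 ^ N / 9\<close>. This is where the
  interval \<open>[-3, 3]\<close> of the limit law comes from: the last digit ranges over a centred interval of
  half-length about \<open>2 ^ N / 2\<close>, compared with a standard deviation of about \<open>2 ^ N / 3\<close> for the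
  sum and half of that for the sum without it.
\<close>

lemma sigmaN_LIMSEQ: "(\<lambda>N. sigmaN N / 2 ^ N) \<longlonglongrightarrow> 1 / 3"
proof -
  have *: "sigmaN N / 2 ^ N = sqrt ((4/3 - 4/3 * (1/4) ^ N - real N * (1/4) ^ N) / 12)" for N
  proof -
    have "sigmaN N / 2 ^ N = sqrt (centred_moment N 2 / 4 ^ N)"
      unfolding sigmaN_eq real_sqrt_divide
      by (simp add: real_sqrt_power)
    also have "centred_moment N 2 / 4 ^ N = (4/3 - 4/3 * (1/4) ^ N - real N * (1/4) ^ N) / 12"
      unfolding centred_moment_2 by (simp add: field_simps power_divide)
    finally show ?thesis .
  qed
  have "(\<lambda>N. sqrt ((4/3 - 4/3 * (1/4) ^ N - real N * (1/4) ^ N) / 12)) \<longlonglongrightarrow> sqrt ((4/3 - 4/3 * 0 - 0) / 12)"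
    by (intro tendsto_intros LIMSEQ_power_zero powser_times_n_limit_0) auto
  also have "sqrt ((4/3 - 4/3 * 0 - 0) / 12) = (1/3 :: real)"
    by (rule real_sqrt_unique) (auto simp: power2_eq_square)
  finally show ?thesis unfolding * .
qed

text \<open>
  A crude lower bound, valid from \<open>N = 1\<close> on (where it is an equality); it serves to bound
  \<open>ZN_hat\<close> uniformly in \<open>N\<close>.
\<close>

lemma sigmaN_ge:
  assumes "N \<ge> 1"
  shows "sigmaN N \<ge> 2 ^ N / 4"
proof -
  have "12 * real N + 16 \<le> 7 * 4 ^ N"
    using assms by (induction N rule: dec_induct) auto
  then have "4 ^ N / 16 \<le> (4 * (4 ^ N - 1) / 3 - real N) / 12" by (simp add: field_simps)
  then have "4 ^ N / 16 \<le> centred_moment N 2" unfolding centred_moment_2 .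
  moreover have "(2 ^ N / 4 :: real)\<^sup>2 = 4 ^ N / 16"
    by (simp add: power_divide power2_eq_square flip: power_mult_distrib)
  ultimately show ?thesis
    unfolding sigmaN_eq by (intro real_le_rsqrt) simp
qed

lemma ZN_hat_bounded:
  assumes "\<omega> \<in> Omega N"
  shows "\<bar>ZN_hat N \<omega>\<bar> \<le> 4"
proof (cases "N = 0")
  case True
  then show ?thesis by (simp add: ZN_hat_def sigmaN_eq centred_moment_2)
next
  case False
  have "ZN N \<omega> - centre N = (\<Sum>j=1..N. real_of_int (\<omega> j) - (2 ^ j - 1) / 2)"
    unfolding ZN_def centre_def by (simp add: sum_subtractf)
  also have "\<bar>\<dots>\<bar> \<le> (\<Sum>j=1..N. 2 ^ j / 2)"
  proof (intro order_trans[OF sum_abs] sum_mono)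
    fix j assume "j \<in> {1..N}"
    then have "\<omega> j \<in> {0..2 ^ j - 1}" using assms unfolding Omega_def by (rule PiE_mem[rotated])
    then have "0 \<le> real_of_int (\<omega> j)" "real_of_int (\<omega> j) \<le> real_of_int (2 ^ j - 1)"
      unfolding of_int_le_iff by auto
    then show "\<bar>real_of_int (\<omega> j) - (2 ^ j - 1) / 2\<bar> \<le> 2 ^ j / 2" by (simp add: abs_le_iff field_simps)
  qed
  also have "\<dots> \<le> 2 ^ N" by (induction N) auto
  finally have "\<bar>ZN N \<omega> - centre N\<bar> \<le> 2 ^ N" .
  also have "2 ^ N \<le> 4 * sigmaN N" using sigmaN_ge[of N] False by simp
  finally have "\<bar>ZN N \<omega> - centre N\<bar> \<le> 4 * sigmaN N" .
  moreover have "sigmaN N > 0" using sigmaN_ge[of N] False by (smt (verit) less_one linorder_not_less zero_less_power divide_pos_pos)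
  ultimately show ?thesis unfolding ZN_hat_def muN_eq by (simp add: abs_divide field_simps)
qed

section \<open>Passage to the limit\<close>

text \<open>
  Weak convergence only controls bounded continuous functions, but here the approximating
  variables are bounded by \<open>4\<close>. Hence so is the limit: a nonnegative bounded continuous function that
  vanishes exactly on \<open>[-4, 4]\<close> has expectation \<open>0\<close> along the sequence, thus also in the limit.
  Powers may therefore be truncated outside \<open>[-4, 4]\<close> without changing any expectation.
\<close>

lemma ZN_hat_moments_converge:
  fixes M :: "'a measure" and Z :: "'a \<Rightarrow> real"
  assumes "prob_space M" and Z [measurable]: "Z \<in> borel_measurable M"
    and conv: "weak_conv_m (\<lambda>N. distr (measure_pmf (P N)) borel (ZN_hat N)) (distr M borel Z)"
  shows "(\<lambda>N. measure_pmf.expectation (P N) (\<lambda>\<omega>. ZN_hat N \<omega> ^ k))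
      \<longlonglongrightarrow> prob_space.expectation M (\<lambda>x. Z x ^ k)"
proof -
  interpret prob_space M by fact
  have lim: "(\<lambda>N. measure_pmf.expectation (P N) (\<lambda>\<omega>. f (ZN_hat N \<omega>))) \<longlonglongrightarrow> expectation (\<lambda>x. f (Z x))"
    if f: "continuous_on UNIV f" "\<And>x. \<bar>f x\<bar> \<le> B" for f :: "real \<Rightarrow> real" and B
  proof -
    have [measurable]: "f \<in> borel_measurable borel"
      using f(1) by (rule borel_measurable_continuous_onI)
    have "(\<lambda>N. integral\<^sup>L (distr (measure_pmf (P N)) borel (ZN_hat N)) f) \<longlonglongrightarrow> integral\<^sup>L (distr M borel Z) f"
    proof (rule weak_conv_imp_integral_bdd_continuous_conv[OF _ _ conv])
      show "real_distribution (distr (measure_pmf (P N)) borel (ZN_hat N))" for N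
        by (rule prob_space.real_distribution_distr[OF prob_space_measure_pmf]) simp
      show "real_distribution (distr M borel Z)" by (rule real_distribution_distr) simp
      show "isCont f x" for x using f(1) by (simp add: continuous_on_eq_continuous_at)
      show "norm (f x) \<le> B" for x using f(2)[of x] by simp
    qed
    then show ?thesis by (simp add: integral_distr)
  qed
  have hat: "AE \<omega> in measure_pmf (P N). \<bar>ZN_hat N \<omega>\<bar> \<le> 4" for N
    by (rule AE_pmfI) (simp add: P_def finite_Omega Omega_nonempty ZN_hat_bounded)

  define h :: "real \<Rightarrow> real" where "h x = min 1 (max 0 (\<bar>x\<bar> - 4))" for x
  have "(\<lambda>N. measure_pmf.expectation (P N) (\<lambda>\<omega>. h (ZN_hat N \<omega>))) \<longlonglongrightarrow> expectation (\<lambda>x. h (Z x))"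
    by (rule lim[of _ 1]) (auto simp: h_def intro!: continuous_intros)
  moreover have "measure_pmf.expectation (P N) (\<lambda>\<omega>. h (ZN_hat N \<omega>)) = 0" for N
    using hat[of N] by (intro integral_eq_zero_AE) (auto simp: h_def)
  ultimately have "expectation (\<lambda>x. h (Z x)) = 0" by (simp add: LIMSEQ_const_iff)
  moreover have "integrable M (\<lambda>x. h (Z x))"
    by (rule integrable_const_bound[of _ 1]) (auto simp: h_def)
  ultimately have "AE x in M. h (Z x) = 0"
    by (subst (asm) integral_nonneg_eq_0_iff_AE) (auto simp: h_def)
  then have bdd: "AE x in M. \<bar>Z x\<bar> \<le> 4"
    by eventually_elim (auto simp: h_def min_def max_def split: if_splits)

  define c :: "real \<Rightarrow> real" where "c x = max (- 4) (min 4 x)" for x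
  have c: "c x = x" if "\<bar>x\<bar> \<le> 4" for x using that by (auto simp: c_def)
  have "(\<lambda>N. measure_pmf.expectation (P N) (\<lambda>\<omega>. c (ZN_hat N \<omega>) ^ k)) \<longlonglongrightarrow> expectation (\<lambda>x. c (Z x) ^ k)"
  proof (rule lim[of "\<lambda>x. c x ^ k" "4 ^ k"])
    show "continuous_on UNIV (\<lambda>x. c x ^ k)" unfolding c_def by (intro continuous_intros)
    show "\<bar>c x ^ k\<bar> \<le> 4 ^ k" for x
      unfolding power_abs by (rule power_mono) (auto simp: c_def)
  qed
  moreover have "measure_pmf.expectation (P N) (\<lambda>\<omega>. c (ZN_hat N \<omega>) ^ k)
      = measure_pmf.expectation (P N) (\<lambda>\<omega>. ZN_hat N \<omega> ^ k)" for N
    using hat[of N] by (intro integral_cong_AE) (auto simp: c)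
  moreover have "expectation (\<lambda>x. c (Z x) ^ k) = expectation (\<lambda>x. Z x ^ k)"
    using bdd by (intro integral_cong_AE) (auto simp: c c_def)
  ultimately show "(\<lambda>N. measure_pmf.expectation (P N) (\<lambda>\<omega>. ZN_hat N \<omega> ^ k))
      \<longlonglongrightarrow> expectation (\<lambda>x. Z x ^ k)" by simp
qed

text \<open>
  These are the moments of the identity in law between \<open>2 Z\<close> and \<open>U + Z\<close>: the limit of
  the recurrence for central moments, scaled by powers of \<open>2 ^ N\<close>, in which the factors
  \<open>3 ^ i\<close> and \<open>3 ^ (k - i)\<close> from the limits of grid moments and standard deviations combine
  to a common \<open>3 ^ k\<close>.
\<close>

lemma moment_recurrence_limit:
  fixes \<mu> :: "nat \<Rightarrow> real"
  assumes "\<And>k. (\<lambda>N. measure_pmf.expectation (P N) (\<lambda>\<omega>. ZN_hat N \<omega> ^ k)) \<longlonglongrightarrow> \<mu> k"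
  shows "2 ^ k * \<mu> k = (\<Sum>i\<le>k. real (k choose i) * unif_moment i * \<mu> (k - i))"
proof -
  have scaled: "(\<lambda>N. centred_moment N l / (2 ^ N) ^ l) \<longlonglongrightarrow> \<mu> l / 3 ^ l" for l
  proof -
    have "(\<lambda>N. centred_moment N l / sigmaN N ^ l * (sigmaN N / 2 ^ N) ^ l) \<longlonglongrightarrow> \<mu> l * (1/3) ^ l"
      using assms[of l] unfolding expectation_ZN_hat_power
      by (intro tendsto_mult tendsto_power sigmaN_LIMSEQ)
    moreover have "eventually (\<lambda>N. centred_moment N l / sigmaN N ^ l * (sigmaN N / 2 ^ N) ^ l
        = centred_moment N l / (2 ^ N) ^ l) sequentially"
      using eventually_ge_at_top[of 1]
    proof eventually_elim
      case (elim N)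
      have "sigmaN N \<noteq> 0" using sigmaN_ge[OF elim] by (smt (verit) divide_pos_pos zero_less_power)
      then show ?case by (simp add: power_divide)
    qed
    ultimately have "(\<lambda>N. centred_moment N l / (2 ^ N) ^ l) \<longlonglongrightarrow> \<mu> l * (1/3) ^ l"
      by (rule Lim_transform_eventually)
    then show ?thesis by (simp add: power_divide)
  qed
  have grid: "(\<lambda>N. grid_moment (2 ^ Suc N) i / (2 ^ N) ^ i) \<longlonglongrightarrow> unif_moment i / 3 ^ i" for i
  proof -
    have "filterlim (\<lambda>N. 2 ^ Suc N :: nat) sequentially sequentially"
      by (rule filterlim_subseq) (simp add: strict_mono_def)
    from tendsto_mult[OF filterlim_compose[OF grid_moment_LIMSEQ this] tendsto_const[of "2 ^ i"]]
    have "(\<lambda>N. grid_moment (2 ^ Suc N) i / real (2 ^ Suc N) ^ i * 2 ^ i) \<longlonglongrightarrow> unif_moment i / 6 ^ i * 2 ^ i" .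
    moreover have "real (2 ^ Suc N) ^ i = (2 ^ N) ^ i * 2 ^ i" for N
      by (simp add: power_mult_distrib)
    moreover have "(6::real) ^ i = 3 ^ i * 2 ^ i" by (simp flip: power_mult_distrib)
    ultimately show ?thesis by simp
  qed
  have "(\<lambda>N. \<Sum>i\<le>k. real (k choose i) * (grid_moment (2 ^ Suc N) i / (2 ^ N) ^ i)
        * (centred_moment N (k - i) / (2 ^ N) ^ (k - i)))
      \<longlonglongrightarrow> (\<Sum>i\<le>k. real (k choose i) * (unif_moment i / 3 ^ i) * (\<mu> (k - i) / 3 ^ (k - i)))"
    by (intro tendsto_sum tendsto_mult tendsto_const grid scaled)
  moreover have "(\<Sum>i\<le>k. real (k choose i) * (grid_moment (2 ^ Suc N) i / (2 ^ N) ^ i)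
        * (centred_moment N (k - i) / (2 ^ N) ^ (k - i)))
      = centred_moment (Suc N) k / (2 ^ Suc N) ^ k * 2 ^ k" for N
  proof -
    have "centred_moment (Suc N) k / (2 ^ Suc N) ^ k * 2 ^ k = centred_moment (Suc N) k / (2 ^ N) ^ k"
      by (simp add: power_mult_distrib)
    also have "\<dots> = (\<Sum>i\<le>k. real (k choose i) * (grid_moment (2 ^ Suc N) i / (2 ^ N) ^ i)
        * (centred_moment N (k - i) / (2 ^ N) ^ (k - i)))"
      unfolding centred_moment_Suc sum_divide_distrib
      by (intro sum.cong) (simp_all add: field_simps flip: power_add)
    finally show ?thesis ..
  qed
  ultimately have "(\<lambda>N. centred_moment (Suc N) k / (2 ^ Suc N) ^ k * 2 ^ k)
      \<longlonglongrightarrow> (\<Sum>i\<le>k. real (k choose i) * (unif_moment i / 3 ^ i) * (\<mu> (k - i) / 3 ^ (k - i)))"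
    by simp
  moreover have "(\<lambda>N. centred_moment (Suc N) k / (2 ^ Suc N) ^ k * 2 ^ k) \<longlonglongrightarrow> \<mu> k / 3 ^ k * 2 ^ k"
    by (intro tendsto_mult tendsto_const LIMSEQ_Suc[OF scaled])
  ultimately have "\<mu> k / 3 ^ k * 2 ^ k
      = (\<Sum>i\<le>k. real (k choose i) * (unif_moment i / 3 ^ i) * (\<mu> (k - i) / 3 ^ (k - i)))"
    by (rule LIMSEQ_unique[rotated])
  also have "\<dots> = (\<Sum>i\<le>k. real (k choose i) * unif_moment i * \<mu> (k - i)) / 3 ^ k"
    unfolding sum_divide_distrib by (intro sum.cong) (simp_all flip: power_add)
  finally show ?thesis by (simp add: field_simps)
qed


section \<open>Exponential generating functions\<close>

unbundle no vec_syntax and fps_syntax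

definition egf :: "(nat \<Rightarrow> real) \<Rightarrow> real fps" where
  "egf a = Abs_fps (\<lambda>k. a k / fact k)"

lemma egf_nth [simp]: "egf a $ k = a k / fact k"
  by (simp add: egf_def)

lemma egf_mult_nth:
  "fact k * (egf a * egf b) $ k = (\<Sum>i\<le>k. real (k choose i) * a i * b (k - i))"
  unfolding fps_mult_nth sum_distrib_left atMost_atLeast0
  by (intro sum.cong) (simp_all add: binomial_fact)

abbreviation dilate :: "real \<Rightarrow> real fps \<Rightarrow> real fps" where
  "dilate c f \<equiv> f oo (fps_const c * fps_X)"

lemma dilate_mult: "dilate c (f * g) = dilate c f * dilate c g"
  by (rule fps_compose_mult_distrib) simp

lemma XD_dilate: "fps_XD (dilate c f) = dilate c (fps_XD f)"
  by (simp add: fps_eq_iff)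

lemma XD_mult: "fps_XD (f * g) = fps_XD f * g + f * fps_XD g" for f g :: "real fps"
  by (simp add: fps_XD_def algebra_simps)

text \<open>The moment generating function of \<open>U\<close>, which is \<open>sinh (3t) / (3t)\<close> by the next lemma.\<close>

abbreviation sinhc :: "real fps" where
  "sinhc \<equiv> egf unif_moment"

lemma sinhc: "fps_const 6 * fps_X * sinhc = fps_exp 3 - fps_exp (- 3)"
proof (rule fps_ext)
  fix k
  show "(fps_const 6 * fps_X * sinhc) $ k = (fps_exp 3 - fps_exp (- 3) :: real fps) $ k"
  proof (cases k)
    case (Suc j)
    have "(fps_exp 3 - fps_exp (- 3) :: real fps) $ k = (3 ^ Suc j - (- 3) ^ Suc j) / fact (Suc j)"
      unfolding Suc by (simp only: fps_sub_nth fps_exp_nth diff_divide_distrib of_nat_fact)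
    also have "3 ^ Suc j - (- 3) ^ Suc j = (if even j then 6 * 3 ^ j else 0 :: real)"
      by simp
    also have "\<dots> / fact (Suc j) = 6 * (unif_moment j / fact j)"
      by (simp add: unif_moment_def fact_Suc del: of_nat_Suc)
    also have "\<dots> = (fps_const 6 * fps_X * sinhc) $ k"
      unfolding Suc mult.assoc by simp
    finally show ?thesis ..
  qed (simp add: mult.assoc)
qed

text \<open>
  Substituting \<open>6t\<close> for \<open>t\<close> in the generating function of the Bernoulli numbers gives
  \<open>6t / (e\<^sup>6\<^sup>t - 1) = e\<^sup>-\<^sup>3\<^sup>t (3t / sinh (3t))\<close>. At \<open>x = 1/2\<close> the Bernoulli polynomials
  contribute a further factor \<open>e\<^sup>3\<^sup>t\<close>, which leaves the inverse of \<open>sinhc\<close>.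
\<close>

lemma egf_bernoulli_mult_sinhc: "egf (\<lambda>k. bernoulli_num k * 6 ^ k) * sinhc = fps_exp (- 3)"
proof -
  let ?b = "egf (\<lambda>k. bernoulli_num k * 6 ^ k)"
  have "?b = dilate 6 (Abs_fps (\<lambda>k. bernoulli_num k / fact k))" by (simp add: fps_eq_iff)
  then have b: "?b * (fps_exp 6 - 1) = fps_const 6 * fps_X"
    using arg_cong[OF bernoulli_num_gf, of "dilate 6"]
    by (simp add: dilate_mult fps_compose_sub_distrib)
  have e: "fps_exp (-3) * (fps_exp 6 - 1) = fps_exp 3 - fps_exp (- 3 :: real)"
    by (simp add: algebra_simps flip: fps_exp_add_mult)
  have "fps_const 6 * fps_X * (?b * sinhc) = ?b * (fps_const 6 * fps_X * sinhc)"
    by (simp only: mult_ac)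
  also have "\<dots> = ?b * (fps_exp 6 - 1) * fps_exp (- 3)"
    unfolding sinhc e[symmetric] by (simp only: mult_ac)
  finally have "fps_const 6 * fps_X * (?b * sinhc) = fps_const 6 * fps_X * fps_exp (- 3)"
    unfolding b .
  then show ?thesis by (subst (asm) mult_left_cancel) auto
qed

lemma egf_bernoulli_half_mult_sinhc: "egf (\<lambda>k. bernoulli_poly k (1/2) * 6 ^ k) * sinhc = 1"
proof -
  let ?b = "egf (\<lambda>k. bernoulli_poly k (1/2) * 6 ^ k)"
  have "?b = dilate 6 (Abs_fps (\<lambda>k. bernoulli_poly k (1/2) / fact k))" by (simp add: fps_eq_iff)
  then have b: "?b * (fps_exp 6 - 1) = fps_const 6 * fps_X * fps_exp 3"
    using arg_cong[OF bernoulli_poly_gf[of "1/2"], of "dilate 6"]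
    by (simp add: dilate_mult fps_compose_sub_distrib)
  have e: "fps_exp (-3) * (fps_exp 6 - 1) = fps_exp 3 - fps_exp (- 3 :: real)"
    by (simp add: algebra_simps flip: fps_exp_add_mult)
  have inv: "fps_exp 3 * fps_exp (-3) = (1 :: real fps)" by (simp flip: fps_exp_add_mult)
  have "fps_const 6 * fps_X * (?b * sinhc) = ?b * (fps_const 6 * fps_X * sinhc)"
    by (simp only: mult_ac)
  also have "\<dots> = ?b * (fps_exp 6 - 1) * fps_exp (- 3)"
    unfolding sinhc e[symmetric] by (simp only: mult_ac)
  also have "\<dots> = fps_const 6 * fps_X * (fps_exp 3 * fps_exp (- 3))"
    unfolding b by (simp only: mult_ac)
  finally have "fps_const 6 * fps_X * (?b * sinhc) = fps_const 6 * fps_X * 1"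
    unfolding inv .
  then show ?thesis by (subst (asm) mult_left_cancel) auto
qed

section \<open>Consequences of the functional equation\<close>

text \<open>
  The moment identity with total mass \<open>1\<close> is all that the three recurrences depend on.
\<close>

locale dilation_moments =
  fixes \<mu> :: "nat \<Rightarrow> real"
  assumes \<mu>_0: "\<mu> 0 = 1"
    and moment_rec: "2 ^ k * \<mu> k = (\<Sum>i\<le>k. real (k choose i) * unif_moment i * \<mu> (k - i))"
begin

text \<open>
  In the recurrence for odd \<open>k\<close>, a term with \<open>i\<close> odd has a vanishing moment of \<open>U\<close>, and one with
  \<open>i\<close> even and positive has a vanishing \<open>\<mu> (k - i)\<close> by induction. What is left is
  \<open>2 ^ k \<mu> k = \<mu> k\<close>.
\<close>

lemma odd_moments_zero:
  assumes "odd k"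
  shows "\<mu> k = 0"
  using \<open>odd k\<close>
proof (induction k rule: less_induct)
  case (less k)
  have "2 ^ k * \<mu> k = (\<Sum>i\<in>{0}. real (k choose i) * unif_moment i * \<mu> (k - i))"
    unfolding moment_rec
  proof (rule sum.mono_neutral_right)
    show "\<forall>i\<in>{..k} - {0}. real (k choose i) * unif_moment i * \<mu> (k - i) = 0"
    proof
      fix i assume i: "i \<in> {..k} - {0}"
      show "real (k choose i) * unif_moment i * \<mu> (k - i) = 0"
      proof (cases "odd i")
        case False
        then have "\<mu> (k - i) = 0" using i less by (intro less.IH) auto
        then show ?thesis by simp
      qed (simp add: unif_moment_def)
    qed
  qed auto
  then have "(2 ^ k - 1) * \<mu> k = 0" by (simp add: unif_moment_def algebra_simps)
  moreover have "(2::real) ^ k \<noteq> 1" using less.prems by (metis odd_pos one_less_power one_less_numeral_iff semiring_norm(76) less_irrefl)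
  ultimately show ?case by simp
qed

lemma egf_functional_equation:
  "dilate 2 (egf \<mu>) = sinhc * egf \<mu>"
proof (rule fps_ext)
  fix k
  have "fact k * dilate 2 (egf \<mu>) $ k = fact k * (sinhc * egf \<mu>) $ k"
    unfolding egf_mult_nth moment_rec[symmetric] by simp
  then show "dilate 2 (egf \<mu>) $ k = (sinhc * egf \<mu>) $ k" by simp
qed

lemma moments_bernoulli_half:
  "\<mu> k = (\<Sum>i\<le>k. real (k choose i) * (bernoulli_poly i (1/2) * 6 ^ i) * (2 ^ (k - i) * \<mu> (k - i)))"
proof -
  let ?b = "egf (\<lambda>k. bernoulli_poly k (1/2) * 6 ^ k)"
  have "dilate 2 (egf \<mu>) = egf (\<lambda>k. 2 ^ k * \<mu> k)" by (simp add: fps_eq_iff)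
  then have "?b * egf (\<lambda>k. 2 ^ k * \<mu> k) = ?b * sinhc * egf \<mu>"
    using egf_functional_equation by (simp only: mult.assoc)
  then have "?b * egf (\<lambda>k. 2 ^ k * \<mu> k) = egf \<mu>"
    unfolding egf_bernoulli_half_mult_sinhc by simp
  then have "\<mu> k = fact k * (?b * egf (\<lambda>k. 2 ^ k * \<mu> k)) $ k" by simp
  then show ?thesis unfolding egf_mult_nth .
qed

text \<open>
  The sequence \<open>L\<close> has \<open>G = t F'/F\<close> as its generating function; its last property is
  \<open>t F' = G F\<close>. The operator \<open>fps_XD\<close>, that is \<open>t d/dt\<close>, is used rather than the derivative
  because it commutes with dilations. The value \<open>L 1\<close> is left open: \<open>6t / (e\<^sup>6\<^sup>t - 1)\<close> and
  \<open>3t coth (3t)\<close> differ in the linear coefficient, and in the sums for even moments the terms of odd index vanish.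
\<close>

lemma moments_bernoulli_num:
  obtains L where "\<And>i. i \<ge> 2 \<Longrightarrow> L i = bernoulli_num i * 6 ^ i / (2 ^ i - 1)" "L 0 = 0"
    "\<And>k. real k * \<mu> k = (\<Sum>i\<le>k. real (k choose i) * L i * \<mu> (k - i))"
proof -
  let ?F = "egf \<mu>" and ?b = "egf (\<lambda>k. bernoulli_num k * 6 ^ k)"
  define G where "G = fps_XD ?F * inverse ?F"
  have F: "inverse ?F * ?F = 1" using \<mu>_0 by (intro inverse_mult_eq_1) simp
  then have FG: "fps_XD ?F = G * ?F" by (simp add: G_def mult.assoc)
  have S: "sinhc $ 0 = 1" by (simp add: unif_moment_def)
  have nz: "?F \<noteq> 0" "sinhc \<noteq> 0"
  proof -
    have "?F $ 0 \<noteq> 0" "sinhc $ 0 \<noteq> 0" using \<mu>_0 S by simp_all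
    then show "?F \<noteq> 0" "sinhc \<noteq> 0" unfolding fps_nonzero_nth by blast+
  qed

  (* Logarithmic differentiation of F(2t) = S(t) F(t). *)
  have "sinhc * ?F * dilate 2 G = dilate 2 G * dilate 2 ?F"
    unfolding egf_functional_equation by (simp only: mult_ac)
  also have "\<dots> = fps_XD (dilate 2 ?F)"
    unfolding XD_dilate FG dilate_mult ..
  also have "\<dots> = fps_XD sinhc * ?F + sinhc * (G * ?F)"
    unfolding egf_functional_equation XD_mult FG ..
  finally have "(sinhc * (dilate 2 G - G)) * ?F = fps_XD sinhc * ?F"
    by (simp add: algebra_simps)
  then have log: "sinhc * (dilate 2 G - G) = fps_XD sinhc" using nz by simp

  (* Both sides are the derivative of 2 t S(t) = (exp(3t) - exp(-3t)) / 3. *)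
  have "2 * (sinhc + fps_XD sinhc) = fps_exp 3 + fps_exp (- 3)"
  proof (rule fps_ext)
    fix k
    have "(2 * (sinhc + fps_XD sinhc)) $ k = 2 * (real (Suc k) * unif_moment k) / fact k"
      by (simp add: numeral_fps_const algebra_simps add_divide_distrib)
    also have "2 * (real (Suc k) * unif_moment k) = 3 ^ k + (- 3) ^ k"
      by (simp add: unif_moment_def del: of_nat_Suc)
    finally show "(2 * (sinhc + fps_XD sinhc)) $ k = (fps_exp 3 + fps_exp (- 3) :: real fps) $ k"
      by (simp add: add_divide_distrib)
  qed
  (* On the other side, b(t) + 3t = 3t coth(3t), because b S = exp(-3t). *)
  moreover have "2 * (sinhc * (?b + 3 * fps_X - 1)) = fps_exp 3 + fps_exp (- 3) - 2 * sinhc"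
  proof -
    have "2 * (sinhc * (?b + 3 * fps_X - 1)) = 2 * (?b * sinhc) + 6 * fps_X * sinhc - 2 * sinhc"
      by (simp add: algebra_simps)
    also have "6 * fps_X * sinhc = fps_exp 3 - fps_exp (- 3)"
      using sinhc by (simp only: numeral_fps_const)
    finally show ?thesis unfolding egf_bernoulli_mult_sinhc by simp
  qed
  ultimately have "2 * (sinhc * (?b + 3 * fps_X - 1)) = 2 * fps_XD sinhc"
    by (simp add: algebra_simps)
  then have "sinhc * (?b + 3 * fps_X - 1) = fps_XD sinhc" by simp
  with log have "sinhc * (dilate 2 G - G) = sinhc * (?b + 3 * fps_X - 1)" by simp
  then have G: "dilate 2 G - G = ?b + 3 * fps_X - 1"
    using nz by simp
  show thesis
  proof (rule that[of "\<lambda>i. fact i * G $ i"])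
    fix i :: nat assume i: "i \<ge> 2"
    have "(2 ^ i - 1) * G $ i = bernoulli_num i * 6 ^ i / fact i"
      using arg_cong[OF G, of "\<lambda>f. f $ i"] i by (simp add: numeral_fps_const left_diff_distrib)
    moreover have "(2::real) ^ i > 1" using i by (intro one_less_power) auto
    ultimately show "fact i * G $ i = bernoulli_num i * 6 ^ i / (2 ^ i - 1)"
      by (simp add: field_simps)
  next
    show "fact 0 * G $ 0 = 0" by (simp add: G_def)
  next
    fix k
    have G_egf: "egf (\<lambda>i. fact i * G $ i) = G" by (simp add: fps_eq_iff)
    have "(\<Sum>i\<le>k. real (k choose i) * (fact i * G $ i) * \<mu> (k - i)) = fact k * (G * ?F) $ k"
      using egf_mult_nth[of k "\<lambda>i. fact i * G $ i" \<mu>] unfolding G_egf by (rule sym)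
    also have "\<dots> = real k * \<mu> k" unfolding FG[symmetric] by simp
    finally show "real k * \<mu> k = (\<Sum>i\<le>k. real (k choose i) * (fact i * G $ i) * \<mu> (k - i))" ..
  qed
qed

lemma sum_even_terms:
  fixes g :: "nat \<Rightarrow> real"
  assumes "\<And>i. odd i \<Longrightarrow> g i = 0"
  shows "(\<Sum>i\<le>2 * n. g i) = g 0 + (\<Sum>j=1..n. g (2 * j))"
  by (induction n) (simp_all add: assms)

section \<open>The three recurrences\<close>

lemma even_moment_recurrence:
  assumes "n \<ge> 1"
  shows "\<mu> (2 * n) = 1 / (real (2 * n + 1) * (2 ^ (2 * n) - 1)) *
    (\<Sum>j=1..n. real ((2 * n + 1) choose (2 * j + 1)) * 3 ^ (2 * j) * \<mu> (2 * n - 2 * j))"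
proof -
  let ?term = "\<lambda>i. real (2 * n choose i) * unif_moment i * \<mu> (2 * n - i)"
  let ?S = "\<Sum>j=1..n. real ((2 * n + 1) choose (2 * j + 1)) * 3 ^ (2 * j) * \<mu> (2 * n - 2 * j)"
  have "2 ^ (2 * n) * \<mu> (2 * n) = ?term 0 + (\<Sum>j=1..n. ?term (2 * j))"
    unfolding moment_rec by (rule sum_even_terms) (simp add: unif_moment_def)
  also have "?term 0 = \<mu> (2 * n)" by (simp add: unif_moment_def)
  also have "(\<Sum>j=1..n. ?term (2 * j)) = ?S / real (2 * n + 1)"
    unfolding sum_divide_distrib
  proof (rule sum.cong)
    fix j
    have "real (2 * j + 1) * real ((2 * n + 1) choose (2 * j + 1)) = real (2 * n + 1) * real (2 * n choose (2 * j))"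
      using Suc_times_binomial[of "2 * j" "2 * n"] by (metis Suc_eq_plus1 of_nat_mult)
    then have ratio: "real (2 * n choose (2 * j)) / real (2 * j + 1) = real ((2 * n + 1) choose (2 * j + 1)) / real (2 * n + 1)"
      by (simp add: frac_eq_eq mult.commute del: of_nat_Suc of_nat_add binomial_Suc_Suc)
    have "?term (2 * j) = real (2 * n choose (2 * j)) / real (2 * j + 1) * 3 ^ (2 * j) * \<mu> (2 * n - 2 * j)"
      by (simp add: unif_moment_def)
    then show "?term (2 * j) = real ((2 * n + 1) choose (2 * j + 1)) * 3 ^ (2 * j) * \<mu> (2 * n - 2 * j) / real (2 * n + 1)"
      unfolding ratio by simp
  qed simp
  finally have "(2 ^ (2 * n) - 1) * \<mu> (2 * n) = ?S / real (2 * n + 1)"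
    by (simp add: algebra_simps)
  moreover have "(2::real) ^ (2 * n) > 1" using assms by (intro one_less_power) auto
  ultimately show ?thesis by (simp add: field_simps del: of_nat_Suc of_nat_add)
qed

lemma even_moment_bernoulli_num:
  assumes "n \<ge> 1"
  shows "\<mu> (2 * n) =
    (\<Sum>j=1..n. real ((2 * n - 1) choose (2 * j - 1)) * (bernoulli_num (2 * j) / real (2 * j)) *
       (6 ^ (2 * j) / (2 ^ (2 * j) - 1)) * \<mu> (2 * n - 2 * j))" (is "_ = ?S")
proof -
  obtain L where L: "\<And>i. i \<ge> 2 \<Longrightarrow> L i = bernoulli_num i * 6 ^ i / (2 ^ i - 1)" "L 0 = 0"
    "\<And>k. real k * \<mu> k = (\<Sum>i\<le>k. real (k choose i) * L i * \<mu> (k - i))"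
    using moments_bernoulli_num by blast
  let ?term = "\<lambda>i. real (2 * n choose i) * L i * \<mu> (2 * n - i)"
  have "real (2 * n) * \<mu> (2 * n) = ?term 0 + (\<Sum>j=1..n. ?term (2 * j))"
    unfolding L(3)
  proof (rule sum_even_terms)
    fix i :: nat assume "odd i"
    then show "?term i = 0" by (cases "i \<le> 2 * n") (simp_all add: odd_moments_zero)
  qed
  also have "\<dots> = (\<Sum>j=1..n. ?term (2 * j))" by (simp add: L)
  also have "\<dots> = real (2 * n) * ?S"
    unfolding sum_distrib_left
  proof (rule sum.cong)
    fix j assume j: "j \<in> {1..n}"
    have "real (2 * j) * real (2 * n choose (2 * j)) = real (2 * n) * real ((2 * n - 1) choose (2 * j - 1))"
      using times_binomial_minus1_eq[of "2 * j" "2 * n"] j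
      by (metis atLeastAtMost_iff nat_0_less_mult_iff of_nat_mult pos2 zero_less_one order_less_le_trans)
    then have "real (2 * n choose (2 * j)) = real (2 * n) * (real ((2 * n - 1) choose (2 * j - 1)) / real (2 * j))"
      using j by (simp add: field_simps)
    then show "?term (2 * j) = real (2 * n) * (real ((2 * n - 1) choose (2 * j - 1)) *
        (bernoulli_num (2 * j) / real (2 * j)) * (6 ^ (2 * j) / (2 ^ (2 * j) - 1)) * \<mu> (2 * n - 2 * j))"
      using j by (simp add: L)
  qed simp
  finally show ?thesis using assms by simp
qed

lemma even_moment_bernoulli_half:
  assumes "n \<ge> 1"
  shows "\<mu> (2 * n) = 2 ^ (2 * n) / (1 - 2 ^ (2 * n)) *
    (\<Sum>j=1..n. real ((2 * n) choose (2 * j)) * 3 ^ (2 * j) * bernoulli_poly (2 * j) (1 / 2) *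
       \<mu> (2 * n - 2 * j))" (is "_ = _ * ?S")
proof -
  let ?term = "\<lambda>i. real (2 * n choose i) * (bernoulli_poly i (1/2) * 6 ^ i) * (2 ^ (2 * n - i) * \<mu> (2 * n - i))"
  have "\<mu> (2 * n) = ?term 0 + (\<Sum>j=1..n. ?term (2 * j))"
    unfolding moments_bernoulli_half[of "2 * n"]
  proof (rule sum_even_terms)
    fix i :: nat assume "odd i"
    then show "?term i = 0" by (cases "i \<le> 2 * n") (simp_all add: odd_moments_zero)
  qed
  also have "?term 0 = 2 ^ (2 * n) * \<mu> (2 * n)"
    using arg_cong[OF egf_bernoulli_half_mult_sinhc, of "\<lambda>f. f $ 0"] by (simp add: unif_moment_def)
  also have "(\<Sum>j=1..n. ?term (2 * j)) = 2 ^ (2 * n) * ?S"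
    unfolding sum_distrib_left
  proof (rule sum.cong)
    fix j assume j: "j \<in> {1..n}"
    have "(6::real) ^ (2 * j) = 3 ^ (2 * j) * 2 ^ (2 * j)" by (simp flip: power_mult_distrib)
    moreover have "(2::real) ^ (2 * n) = 2 ^ (2 * j) * 2 ^ (2 * n - 2 * j)"
      using j by (simp flip: power_add)
    ultimately show "?term (2 * j) = 2 ^ (2 * n) * (real ((2 * n) choose (2 * j)) * 3 ^ (2 * j) *
        bernoulli_poly (2 * j) (1 / 2) * \<mu> (2 * n - 2 * j))"
      by (simp only: mult_ac)
  qed simp
  finally have "(1 - 2 ^ (2 * n)) * \<mu> (2 * n) = 2 ^ (2 * n) * ?S" by (simp add: algebra_simps)
  moreover have "(2::real) ^ (2 * n) > 1" using assms by (intro one_less_power) auto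
  ultimately show ?thesis by (simp add: field_simps)
qed

end

theorem theorem4p1:
  fixes M :: "'a measure" and Z :: "'a \<Rightarrow> real" and m :: "nat \<Rightarrow> real" and n :: nat
  assumes "prob_space M"
    and "Z \<in> borel_measurable M"
    and "weak_conv_m (\<lambda>N. distr (measure_pmf (P N)) borel (ZN_hat N)) (distr M borel Z)"
    and "\<And>k. m (2 * k) = prob_space.expectation M (\<lambda>x. Z x ^ (2 * k))"
    and "n \<ge> 1"
  shows "(m (2 * n) = 1 / (real (2 * n + 1) * (2 ^ (2 * n) - 1)) *
           (\<Sum>j=1..n. real ((2 * n + 1) choose (2 * j + 1)) * 3 ^ (2 * j) * m (2 * n - 2 * j))) \<and>
         (m (2 * n) =
           (\<Sum>j=1..n. real ((2 * n - 1) choose (2 * j - 1)) * (bernoulli_num (2 * j) / real (2 * j)) *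
              (6 ^ (2 * j) / (2 ^ (2 * j) - 1)) * m (2 * n - 2 * j))) \<and>
         (m (2 * n) = 2 ^ (2 * n) / (1 - 2 ^ (2 * n)) *
           (\<Sum>j=1..n. real ((2 * n) choose (2 * j)) * 3 ^ (2 * j) * bernoulli_poly (2 * j) (1 / 2) *
              m (2 * n - 2 * j)))"
proof -
  interpret prob_space M by fact
  define \<mu> where "\<mu> k = expectation (\<lambda>x. Z x ^ k)" for k
  interpret dilation_moments \<mu>
  proof
    show "\<mu> 0 = 1" by (simp add: \<mu>_def prob_space)
    show "2 ^ k * \<mu> k = (\<Sum>i\<le>k. real (k choose i) * unif_moment i * \<mu> (k - i))" for k
      unfolding \<mu>_def by (intro moment_recurrence_limit ZN_hat_moments_converge assms)
  qed
  have m: "m (2 * k) = \<mu> (2 * k)" for k by (simp add: assms(4) \<mu>_def)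
  have m_diff: "m (2 * n - 2 * j) = \<mu> (2 * n - 2 * j)" for j
    using m[of "n - j"] by (simp add: diff_mult_distrib2)
  show ?thesis
    unfolding m m_diff
    using even_moment_recurrence even_moment_bernoulli_num even_moment_bernoulli_half \<open>n \<ge> 1\<close> by blast
qed

end
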